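(* Let $n \geq 1$ and let $(a_1, a_2, \ldots, a_n)$ be a palindromic sequence of positive integers (i.e. $a_i = a_{n+1-i}$ for all $i$). Then there exist integers $k_1$, $w$, $z$, depending only on the sequence $(a_1,\ldots,a_n)$, such that for every integer $k \geq k_1$ we have $w + zk \geq 1$ and the real number $$\alpha = [0; \overline{a_1, a_2, \ldots, a_n, w + zk}]$$ is an algebraic integer of degree $2$ with $0 < \alpha < 1$. In particular, there exist infinitely many algebraic integers $\alpha$ of degree $2$ with $0<\alpha<1$ of this form.
   Context: For integers $b_0$ and positive integers $b_1, b_2, \ldots$, $[b_0; b_1, b_2, \ldots]$ denotes the simple continued fraction $b_0 + \cfrac{1}{b_1 + \cfrac{1}{b_2 + \cdots}}$, and $\overline{c_1, \ldots, c_r}$ denotes that the block $c_1, \ldots, c_r$ is repeated periodically forever. *)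

theory Defs
  imports "HOL-Computational_Algebra.Computational_Algebra"
begin

primrec cf_convergent :: "nat \<Rightarrow> (nat \<Rightarrow> int) \<Rightarrow> real" where
  "cf_convergent 0 b = of_int (b 0)"
| "cf_convergent (Suc m) b = of_int (b 0) + 1 / cf_convergent m (\<lambda>i. b (Suc i))"

(* [b 0; b 1, b 2, ...]; only meaningful if b i > 0 for all i \<ge> 1, which guarantees that
   the limit exists. *)
definition cf_value :: "(nat \<Rightarrow> int) \<Rightarrow> real" where
  "cf_value b = lim (\<lambda>m. cf_convergent m b)"

(* [b0; c_1, ..., c_r, c_1, ..., c_r, ...] for the nonempty block cs = [c_1, ..., c_r]. *)
definition cf_periodic :: "int \<Rightarrow> int list \<Rightarrow> real" where
  "cf_periodic b0 cs = cf_value (\<lambda>i. case i of 0 \<Rightarrow> b0 | Suc j \<Rightarrow> cs ! (j mod length cs))"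

(* Degree over the rationals, i.e. the degree of the minimal polynomial; only meaningful for
   algebraic x. *)
definition alg_degree :: "real \<Rightarrow> nat" where
  "alg_degree x =
     (LEAST d. \<exists>p :: rat poly. p \<noteq> 0 \<and> degree p = d \<and> poly (map_poly of_rat p) x = 0)"

end

theory Submission
  imports Defs
begin

text \<open>
  Write the product of the matrices \<open>(a\<^sub>i, 1; 1, 0)\<close> as \<open>(p, q; r, s)\<close>. For a palindrome it is
  symmetric, so \<open>q = r\<close> and \<open>p s - q\<^sup>2 = (-1)\<^sup>n\<close>, and the value \<open>\<alpha>\<close> of the continued fraction with
  last partial quotient \<open>m\<close> is a root of \<open>p x\<^sup>2 + p m x - (q m + s)\<close>. Since \<open>q\<^sup>2 \<equiv> -(-1)\<^sup>n\<close> modulo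
  \<open>p\<close>, the residue class \<open>m \<equiv> (-1)\<^sup>n q s\<close> makes \<open>p\<close> divide \<open>q m + s\<close>, and \<open>\<alpha>\<close> becomes an algebraic
  integer. It lies strictly between 0 and 1, so it is not rational. Two different values of \<open>m\<close>
  cannot give the same \<open>\<alpha>\<close>, because the difference of the two monic equations would make \<open>\<alpha>\<close>
  rational.
\<close>

section \<open>Convergence of continued fractions with positive partial quotients\<close>

lemma cf_convergent_ge:
  assumes "\<And>i. b (Suc i) \<ge> 1"
  shows "cf_convergent m b \<ge> of_int (b 0)"
  using assms
proof (induction m arbitrary: b)
  case (Suc m)
  have "cf_convergent m (\<lambda>i. b (Suc i)) \<ge> of_int (b (Suc 0))"
    using Suc.IH[of "\<lambda>i. b (Suc i)"] Suc.prems by simp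
  moreover have "of_int (b (Suc 0)) \<ge> (1::real)"
    using Suc.prems[of 0] by simp
  ultimately show ?case by simp
qed simp

lemma cf_convergent_ge_1:
  assumes "\<And>i. b i \<ge> 1"
  shows "cf_convergent m b \<ge> 1"
proof -
  have "(1::real) \<le> of_int (b 0)" using assms[of 0] by simp
  also have "\<dots> \<le> cf_convergent m b" using assms by (intro cf_convergent_ge)
  finally show ?thesis .
qed

text \<open>A single step \<open>u\<close> to \<open>b 0 + 1 / u\<close> does not contract uniformly
  near \<open>u = 1\<close>, but two steps do: differences shrink by the factor
  \<open>1 / ((d * u + 1) * (d * v + 1))\<close>, at most 1/2 for arguments at least 1. Hence the
  induction in steps of two and the exponent \<open>m div 2\<close>.\<close>

lemma cf_convergent_dist:
  assumes "\<And>i. b (Suc i) \<ge> 1"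
  shows "\<bar>cf_convergent (m + k) b - cf_convergent m b\<bar> \<le> (1/2) ^ (m div 2)"
  using assms
proof (induction m arbitrary: b rule: induct_nat_012)
  case 0
  show ?case
  proof (cases k)
    case (Suc k')
    have "cf_convergent k' (\<lambda>i. b (Suc i)) \<ge> 1"
      by (intro cf_convergent_ge_1 0)
    then show ?thesis using Suc by simp
  qed simp
next
  case 1
  have ge: "cf_convergent j (\<lambda>i. b (Suc i)) \<ge> 1" for j
    by (intro cf_convergent_ge_1 1)
  have "0 < 1 / cf_convergent j (\<lambda>i. b (Suc i))" "1 / cf_convergent j (\<lambda>i. b (Suc i)) \<le> 1" for j
    using ge[of j] by auto
  from this[of k] this[of 0]
  have "\<bar>1 / cf_convergent k (\<lambda>i. b (Suc i)) - 1 / cf_convergent 0 (\<lambda>i. b (Suc i))\<bar> \<le> 1"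
    by linarith
  then show ?case by simp
next
  case (ge2 m)
  define b1 b2 where "b1 = (\<lambda>i. b (Suc i))" and "b2 = (\<lambda>i. b1 (Suc i))"
  define u v where "u = cf_convergent (m + k) b2" and "v = cf_convergent m b2"
  define d where "d = real_of_int (b1 0)"
  have u: "u \<ge> 1" and v: "v \<ge> 1"
    unfolding u_def v_def b2_def b1_def by (intro cf_convergent_ge_1 ge2.prems)+
  have d: "d \<ge> 1"
    unfolding d_def b1_def using ge2.prems[of 0] by simp
  have du: "d * u + 1 \<ge> 2" and dv: "d * v + 1 \<ge> 1"
    using u v d mult_mono[of 1 d 1 u] by auto
  have "2 * 1 \<le> (d * u + 1) * (d * v + 1)"
    by (rule mult_mono) (use du dv in auto)
  then have le: "1 / ((d * u + 1) * (d * v + 1)) \<le> 1 / 2"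
    by (simp add: divide_simps)
  have pos: "u > 0" "v > 0" "d * u + 1 > 0" "d * v + 1 > 0"
    using u v du dv by auto
  have "cf_convergent (Suc (Suc m) + k) b - cf_convergent (Suc (Suc m)) b
      = 1 / (d + 1 / u) - 1 / (d + 1 / v)"
    by (simp add: u_def v_def d_def b1_def b2_def)
  also have "d + 1 / u = (d * u + 1) / u"
    using pos by (simp add: field_simps)
  also have "d + 1 / v = (d * v + 1) / v"
    using pos by (simp add: field_simps)
  also have "1 / ((d * u + 1) / u) - 1 / ((d * v + 1) / v)
      = (u - v) * (1 / ((d * u + 1) * (d * v + 1)))"
    using pos by (simp add: divide_simps) (simp add: algebra_simps)
  finally have "\<bar>cf_convergent (Suc (Suc m) + k) b - cf_convergent (Suc (Suc m)) b\<bar>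
      = \<bar>u - v\<bar> * (1 / ((d * u + 1) * (d * v + 1)))"
    using pos by (simp add: abs_mult)
  also have "\<dots> \<le> (1/2) ^ (m div 2) * (1 / 2)"
  proof (rule mult_mono)
    show "\<bar>u - v\<bar> \<le> (1/2) ^ (m div 2)"
      unfolding u_def v_def by (rule ge2.IH(1)) (simp add: b1_def b2_def ge2.prems)
  qed (use le pos in auto)
  finally show ?case by simp
qed

lemma convergent_cf_convergent:
  assumes "\<And>i. b (Suc i) \<ge> 1"
  shows "convergent (\<lambda>m. cf_convergent m b)"
proof -
  have "Cauchy (\<lambda>m. cf_convergent m b)"
  proof (rule CauchyI')
    fix e :: real assume "e > 0"
    then obtain N where N: "(1/2) ^ N < e"
      using real_arch_pow_inv[of e "1/2"] by auto
    \<comment> \<open>The bound halves only once every two indices, so the threshold is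
      \<open>2 * N\<close>.\<close>
    have "dist (cf_convergent m b) (cf_convergent l b) < e" if "m \<ge> 2 * N" "l > m" for m l
    proof -
      have "\<bar>cf_convergent (m + (l - m)) b - cf_convergent m b\<bar> \<le> (1/2) ^ (m div 2)"
        by (intro cf_convergent_dist assms)
      also have "\<dots> \<le> (1/2) ^ N"
        using that by (intro power_decreasing) auto
      finally show ?thesis using that N by (simp add: dist_real_def)
    qed
    then show "\<exists>M. \<forall>m\<ge>M. \<forall>l>m. dist (cf_convergent m b) (cf_convergent l b) < e"
      by blast
  qed
  then show ?thesis by (simp add: Cauchy_convergent_iff)
qed

lemma cf_convergent_tendsto:
  assumes "\<And>i. b (Suc i) \<ge> 1"
  shows "(\<lambda>m. cf_convergent m b) \<longlonglongrightarrow> cf_value b"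
  unfolding cf_value_def
  by (intro convergent_LIMSEQ_iff[THEN iffD1] convergent_cf_convergent assms)

lemma cf_value_ge_1:
  assumes "\<And>i. b i \<ge> 1"
  shows "cf_value b \<ge> 1"
  using cf_convergent_tendsto[of b] cf_convergent_ge_1[of b] assms
  by (intro LIMSEQ_le_const) auto

lemma cf_value_rec:
  assumes "\<And>i. b (Suc i) \<ge> 1"
  shows "cf_value b = of_int (b 0) + 1 / cf_value (\<lambda>i. b (Suc i))"
proof (rule LIMSEQ_unique)
  show "(\<lambda>m. cf_convergent (Suc m) b) \<longlonglongrightarrow> cf_value b"
    by (intro LIMSEQ_Suc cf_convergent_tendsto assms)
  have "cf_value (\<lambda>i. b (Suc i)) \<noteq> 0"
    using cf_value_ge_1[of "\<lambda>i. b (Suc i)"] assms by fastforce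
  then show "(\<lambda>m. cf_convergent (Suc m) b) \<longlonglongrightarrow> of_int (b 0) + 1 / cf_value (\<lambda>i. b (Suc i))"
    unfolding cf_convergent.simps using assms
    by (intro tendsto_intros cf_convergent_tendsto) auto
qed

section \<open>Continuants as matrix products, and the quadratic equation of a periodic
  fraction\<close>

text \<open>The entries \<open>(p, q, r, s)\<close> of the product of the matrices \<open>(x, 1; 1, 0)\<close> over the list.\<close>

fun cf_matrix :: "int list \<Rightarrow> int \<times> int \<times> int \<times> int" where
  "cf_matrix [] = (1, 0, 0, 1)"
| "cf_matrix (x # xs) = (case cf_matrix xs of (p, q, r, s) \<Rightarrow> (x * p + r, x * q + s, p, q))"

lemma cf_matrix_snoc:
  "cf_matrix (xs @ [x]) = (case cf_matrix xs of (p, q, r, s) \<Rightarrow> (p * x + q, p, r * x + s, r))"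
  by (induction xs) (auto simp: algebra_simps split: prod.splits)

text \<open>Each factor \<open>(x, 1; 1, 0)\<close> is symmetric, so reversing the order of the
  factors transposes the product. For a palindrome this forces \<open>q = r\<close>.\<close>

lemma cf_matrix_rev:
  "cf_matrix (rev xs) = (case cf_matrix xs of (p, q, r, s) \<Rightarrow> (p, r, q, s))"
  by (induction xs) (auto simp: cf_matrix_snoc algebra_simps split: prod.splits)

text \<open>Every factor has determinant -1.\<close>

lemma cf_matrix_det:
  "cf_matrix xs = (p, q, r, s) \<Longrightarrow> p * s - q * r = (-1) ^ length xs"
proof (induction xs arbitrary: p q r s)
  case (Cons x xs)
  obtain p' q' r' s' where eq: "cf_matrix xs = (p', q', r', s')"
    by (cases "cf_matrix xs") auto
  then have "p = x * p' + r'" "q = x * q' + s'" "r = p'" "s = q'"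
    using Cons.prems by auto
  then show ?case using Cons.IH[OF eq] by (simp add: algebra_simps)
qed auto

lemma cf_matrix_nonneg:
  assumes "cf_matrix xs = (p, q, r, s)" and "\<forall>x\<in>set xs. x \<ge> 1"
  shows "p \<ge> 1 \<and> q \<ge> 0 \<and> r \<ge> 0 \<and> s \<ge> 0"
  using assms
proof (induction xs arbitrary: p q r s)
  case (Cons x xs)
  obtain p' q' r' s' where eq: "cf_matrix xs = (p', q', r', s')"
    by (cases "cf_matrix xs") auto
  have nn: "p' \<ge> 1 \<and> q' \<ge> 0 \<and> r' \<ge> 0 \<and> s' \<ge> 0" and x: "x \<ge> 1"
    using Cons.IH[OF eq] Cons.prems by auto
  have "x * p' \<ge> 1" "x * q' \<ge> 0"
    using nn x mult_mono[of 1 x 1 p'] by auto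
  then show ?case using Cons.prems eq nn by auto
qed auto

text \<open>The matrix of the prefix acts as a Moebius map sending the tail \<open>y\<close> to the
  whole value. In cross-multiplied form the induction carries no condition on the
  denominator.\<close>

lemma cf_value_prefix:
  assumes "\<And>i. b i \<ge> 1" and "\<And>i. i < length xs \<Longrightarrow> b i = xs ! i"
    and "cf_matrix xs = (p, q, r, s)"
    and "y = cf_value (\<lambda>i. b (i + length xs))"
  shows "cf_value b * (of_int r * y + of_int s) = of_int p * y + of_int q"
  using assms
proof (induction xs arbitrary: b p q r s)
  case (Cons x xs)
  define x1 where "x1 = cf_value (\<lambda>i. b (Suc i))"
  obtain p' q' r' s' where eq: "cf_matrix xs = (p', q', r', s')"
    by (cases "cf_matrix xs") auto
  have IH: "x1 * (of_int r' * y + of_int s') = of_int p' * y + of_int q'"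
    unfolding x1_def
  proof (rule Cons.IH)
    show "b (Suc i) = xs ! i" if "i < length xs" for i
      using Cons.prems(2)[of "Suc i"] that by simp
  qed (use Cons.prems eq in auto)
  have "x1 \<ge> 1"
    unfolding x1_def by (intro cf_value_ge_1 Cons.prems)
  have b: "cf_value b = of_int x + 1 / x1"
    using cf_value_rec[of b] Cons.prems(1) Cons.prems(2)[of 0] by (simp add: x1_def)
  have "cf_value b * (of_int p' * y + of_int q')
      = of_int x * (of_int p' * y + of_int q') + (of_int r' * y + of_int s')"
    unfolding b IH[symmetric] using \<open>x1 \<ge> 1\<close> by (simp add: field_simps)
  then show ?case
    using Cons.prems(3) eq by (auto simp: algebra_simps)
next
  case Nil
  then show ?case by simp
qed

text \<open>The purely periodic value \<open>x\<close> is its own tail after one period, hence a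
  fixed point of the Moebius map of \<open>cs\<close>. The leading 0 makes
  \<open>\<alpha> = 1 / x\<close>, and dividing the fixed point equation by the square of
  \<open>x\<close> gives the quadratic for \<open>\<alpha>\<close>.\<close>

lemma cf_periodic_zero:
  assumes "cs \<noteq> []" and "\<forall>c\<in>set cs. c \<ge> 1" and M: "cf_matrix cs = (p, q, r, s)"
    and "\<alpha> = cf_periodic 0 cs"
  shows "0 < \<alpha>" and "\<alpha> < 1" and "of_int q * \<alpha>\<^sup>2 + of_int p * \<alpha> = of_int s * \<alpha> + of_int r"
proof -
  define b where "b = (\<lambda>j. cs ! (j mod length cs))"
  define x where "x = cf_value b"
  have b: "b i \<ge> 1" for i
    using assms(1,2) by (auto simp: b_def)
  have per: "(\<lambda>i. b (i + length cs)) = b"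
    by (simp add: b_def)
  have "cf_value (\<lambda>i. b (Suc i)) \<ge> 1"
    by (intro cf_value_ge_1 b)
  then have "1 / cf_value (\<lambda>i. b (Suc i)) > 0"
    by simp
  moreover have "x = of_int (b 0) + 1 / cf_value (\<lambda>i. b (Suc i))"
    unfolding x_def by (intro cf_value_rec b)
  \<comment> \<open>Strictness comes from the positive reciprocal of the tail; it is what gives
    \<open>\<alpha> < 1\<close>.\<close>
  ultimately have x: "x > 1"
    using of_int_le_iff[of 1 "b 0"] b[of 0] by linarith
  have "\<alpha> = 1 / x"
    using cf_value_rec[of "case_nat 0 b"] b unfolding assms(4) cf_periodic_def x_def b_def by simp
  then show "0 < \<alpha>" "\<alpha> < 1" using x by auto
  have "x * (of_int r * x + of_int s) = of_int p * x + of_int q"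
    by (rule cf_value_prefix[of b cs p q r s x, folded x_def]) (simp_all add: b M per, simp_all add: b_def x_def)
  then show "of_int q * \<alpha>\<^sup>2 + of_int p * \<alpha> = of_int s * \<alpha> + of_int r"
    using x unfolding \<open>\<alpha> = 1 / x\<close> by (simp add: field_simps power2_eq_square)
qed

section \<open>Algebraic integers of degree two\<close>

lemma algebraic_int_quadratic:
  fixes x :: real and m c :: int
  assumes "x\<^sup>2 + of_int m * x = of_int c"
  shows "algebraic_int x"
proof (rule algebraic_int.intros)
  show "poly [:- of_int c, of_int m, 1:] x = 0"
    using assms by (simp add: algebra_simps power2_eq_square)
qed (auto simp: coeff_pCons split: nat.splits)

text \<open>The monic quadratic attains degree 2, while a nonzero rational polynomial of degree at
  most 1 vanishing at \<open>x\<close> would make \<open>x\<close> rational.\<close>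

lemma alg_degree_quadratic:
  fixes x :: real and m c :: int
  assumes "x\<^sup>2 + of_int m * x = of_int c" and "x \<notin> \<rat>"
  shows "alg_degree x = 2"
  unfolding alg_degree_def
proof (rule Least_equality)
  have "poly (map_poly of_rat [:- of_int c, of_int m, 1:]) x = 0"
    using assms(1) by (simp add: map_poly_pCons of_rat_minus algebra_simps power2_eq_square)
  then show "\<exists>p :: rat poly. p \<noteq> 0 \<and> degree p = 2 \<and> poly (map_poly of_rat p) x = 0"
    by (intro exI[of _ "[:- of_int c, of_int m, 1:]"]) auto
next
  fix d
  assume "\<exists>p :: rat poly. p \<noteq> 0 \<and> degree p = d \<and> poly (map_poly of_rat p) x = 0"
  then obtain p :: "rat poly" where p: "p \<noteq> 0" "degree p = d" "poly (map_poly of_rat p) x = 0"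
    by blast
  show "2 \<le> d"
  proof (rule ccontr)
    assume "\<not> 2 \<le> d"
    then have "degree p \<le> 1" using p by simp
    obtain u p' where u: "p = pCons u p'"
      by (cases p) auto
    then have "degree p' = 0"
      using \<open>degree p \<le> 1\<close> by (simp add: degree_pCons_eq_if split: if_splits)
    then obtain v where uv: "p = [:u, v:]"
      using u by (auto elim: degree_eq_zeroE)
    have eq: "of_rat u + x * of_rat v = 0"
      using p(3) by (simp add: uv map_poly_pCons)
    show False
    proof (cases "v = 0")
      case True
      then show False using eq p(1) by (simp add: uv)
    next
      case False
      then have "x = of_rat (- u / v)"
        using eq by (simp add: of_rat_divide of_rat_minus field_simps)
      then show False using assms(2) by (metis Rats_of_rat)
    qed
  qed
qed

text \<open>A rational algebraic integer is an integer, and none lies strictly between 0 and 1. This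
  replaces any study of the discriminant.\<close>

lemma algebraic_int_between_0_1_irrational:
  fixes x :: real
  assumes "algebraic_int x" "0 < x" "x < 1"
  shows "x \<notin> \<rat>"
proof
  assume "x \<in> \<rat>"
  then have "x \<in> \<int>"
    using assms(1) by (intro rational_algebraic_int_is_int)
  then show False using assms(2,3) by (auto elim!: Ints_cases)
qed

section \<open>The family attached to a palindrome\<close>

theorem theorem2p2:
  fixes n :: nat and a :: "int list"
  assumes "n \<ge> 1"
    and "length a = n"
    and "\<forall>i<n. a ! i > 0"
    and "\<forall>i<n. a ! i = a ! (n - 1 - i)"
  shows "\<exists>k1 w z :: int.
    (\<forall>k\<ge>k1. w + z * k \<ge> 1 \<and>
       (let \<alpha> = cf_periodic 0 (a @ [w + z * k])
        in algebraic_int \<alpha> \<and> alg_degree \<alpha> = 2 \<and> 0 < \<alpha> \<and> \<alpha> < 1)) \<and>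
    infinite {\<alpha> :: real. algebraic_int \<alpha> \<and> alg_degree \<alpha> = 2 \<and> 0 < \<alpha> \<and> \<alpha> < 1 \<and>
      (\<exists>k\<ge>k1. \<alpha> = cf_periodic 0 (a @ [w + z * k]))}"
proof -
  have pos: "\<forall>x\<in>set a. x \<ge> 1"
    using assms(2,3) by (force simp: in_set_conv_nth)
  have palindrome: "rev a = a"
  proof (rule nth_equalityI)
    fix i assume "i < length (rev a)"
    then have i: "i < n" using assms(2) by simp
    then have "rev a ! i = a ! (n - 1 - i)"
      using assms(2) by (simp add: rev_nth)
    also have "\<dots> = a ! i" using assms(4) i by metis
    finally show "rev a ! i = a ! i" .
  qed simp
  obtain p q r s where M: "cf_matrix a = (p, q, r, s)"
    by (cases "cf_matrix a") auto
  have "q = r"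
    using cf_matrix_rev[of a] unfolding palindrome M prod.case by blast
  then have M: "cf_matrix a = (p, q, q, s)"
    using M by simp
  have p: "p \<ge> 1"
    using cf_matrix_nonneg[OF M pos] by simp
  define e :: int where "e = (-1) ^ n"
  have "e * e = 1"
    by (cases "even n") (simp_all add: e_def)
  have det: "p * s - q * q = e"
    using cf_matrix_det[OF M] assms(2) by (simp add: e_def)
  \<comment> \<open>Modulo \<open>p\<close>, \<open>det\<close> gives \<open>q * q = -e\<close>, so
    \<open>q * w = -e * e * s = -s\<close>. Steps of \<open>p\<close> preserve this class, so
    \<open>p\<close> serves as \<open>z\<close>.\<close>
  define w where "w = e * q * s"
  \<comment> \<open>Since \<open>p \<ge> 1\<close>, \<open>k \<ge> k1\<close> gives
    \<open>w + p * k \<ge> w + 1 + \<bar>w\<bar> \<ge> 1\<close>.\<close>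
  define k1 where "k1 = 1 + \<bar>w\<bar>"
  define m where "m = (\<lambda>k. w + p * k)"
  define A where "A = (\<lambda>k. cf_periodic 0 (a @ [m k]))"
  have dvd: "q * m k + s = p * (e * s * s + q * k)" for k
  proof -
    have "q * m k + s = e * s * (q * q) + s + p * (q * k)"
      by (simp add: m_def w_def algebra_simps)
    also have "q * q = p * s - e"
      using det by simp
    also have "e * s * (p * s - e) = p * (e * s * s) - (e * e) * s"
      by (simp add: algebra_simps)
    finally show ?thesis
      using \<open>e * e = 1\<close> by (simp add: algebra_simps)
  qed
  have m_ge: "m k \<ge> 1" if "k \<ge> k1" for k
  proof -
    have "1 * k \<le> p * k"
      using p that by (intro mult_right_mono) (auto simp: k1_def)
    then show ?thesis using that by (auto simp: m_def k1_def)
  qed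
  have A: "0 < A k" "A k < 1" "(A k)\<^sup>2 + of_int (m k) * A k = of_int (e * s * s + q * k)"
    if "k \<ge> k1" for k
  proof -
    have pos': "\<forall>c\<in>set (a @ [m k]). c \<ge> 1"
      using pos m_ge[OF that] by auto
    have M': "cf_matrix (a @ [m k]) = (p * m k + q, p, q * m k + s, q)"
      by (simp add: cf_matrix_snoc M)
    have A_eq: "A k = cf_periodic 0 (a @ [m k])"
      by (simp add: A_def)
    note * = cf_periodic_zero[OF _ pos' M' A_eq]
    show "0 < A k" "A k < 1" using * by auto
    \<comment> \<open>The terms \<open>q * A k\<close> on both sides cancel, and by
      \<open>dvd\<close> everything left is divisible by \<open>p\<close>; the quotient is
      monic.\<close>
    have "of_int p * (A k)\<^sup>2 + of_int (p * m k + q) * A k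
        = of_int q * A k + of_int (p * (e * s * s + q * k))"
      using *(3) unfolding dvd by simp
    then have "of_int p * ((A k)\<^sup>2 + of_int (m k) * A k) = of_int p * of_int (e * s * s + q * k)"
      by (simp add: algebra_simps)
    then show "(A k)\<^sup>2 + of_int (m k) * A k = of_int (e * s * s + q * k)"
      using p by (subst (asm) mult_cancel_left) auto
  qed
  have alg: "algebraic_int (A k)" if "k \<ge> k1" for k
    using A(3)[OF that] by (rule algebraic_int_quadratic)
  have irrat: "A k \<notin> \<rat>" if "k \<ge> k1" for k
    using alg A(1,2) that by (intro algebraic_int_between_0_1_irrational) auto
  have deg: "alg_degree (A k) = 2" if "k \<ge> k1" for k
    using A(3)[OF that] irrat[OF that] by (rule alg_degree_quadratic)
  have "inj_on A {k1..}"
  proof (rule inj_onI)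
    fix k l assume kl: "k \<in> {k1..}" "l \<in> {k1..}" and eq: "A k = A l"
    \<comment> \<open>Subtracting the two monic equations removes the square and leaves a linear
      relation with integer coefficients.\<close>
    have "(of_int (m k) - of_int (m l)) * A k
        = of_int (e * s * s + q * k) - of_int (e * s * s + q * l)"
      using A(3)[of k] A(3)[of l] kl eq by (simp add: left_diff_distrib)
    then have *: "of_int (m k - m l) * A k = of_int (q * k - q * l)"
      by (simp add: algebra_simps)
    have "m k = m l"
    proof (rule ccontr)
      assume "m k \<noteq> m l"
      then have "real_of_int (m k - m l) \<noteq> 0"
        by (simp only: of_int_eq_0_iff)
      then have "A k = of_int (q * k - q * l) / of_int (m k - m l)"
        using * by (metis nonzero_mult_div_cancel_left)
      then have "A k \<in> \<rat>" by (metis Rats_divide Rats_of_int)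
      then show False using irrat kl by auto
    qed
    then show "k = l" using p by (simp add: m_def)
  qed
  then have "infinite (A ` {k1..})"
    using infinite_Ici by (simp add: finite_image_iff)
  moreover have "A ` {k1..} \<subseteq> {\<alpha>. algebraic_int \<alpha> \<and> alg_degree \<alpha> = 2 \<and> 0 < \<alpha> \<and> \<alpha> < 1 \<and>
      (\<exists>k\<ge>k1. \<alpha> = cf_periodic 0 (a @ [w + p * k]))}"
    using alg deg A(1,2) by (auto simp: A_def m_def)
  ultimately have "infinite {\<alpha>. algebraic_int \<alpha> \<and> alg_degree \<alpha> = 2 \<and> 0 < \<alpha> \<and> \<alpha> < 1 \<and>
      (\<exists>k\<ge>k1. \<alpha> = cf_periodic 0 (a @ [w + p * k]))}"
    by (rule infinite_super[rotated])
  moreover have "\<forall>k\<ge>k1. w + p * k \<ge> 1 \<and> (let \<alpha> = cf_periodic 0 (a @ [w + p * k])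
      in algebraic_int \<alpha> \<and> alg_degree \<alpha> = 2 \<and> 0 < \<alpha> \<and> \<alpha> < 1)"
    using alg deg A(1,2) m_ge by (auto simp: A_def m_def Let_def)
  ultimately show ?thesis by blast
qed

end
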